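(* Let $X$ be a Banach lattice such that $X_n^\sim$ separates points of $X$ (this is satisfied if $X$ is order continuous). Let $(x_\alpha)$ be a norm bounded positive increasing net in $X$. Then $(x_\alpha)$ is uo-Cauchy in $X$.
   Context: A net $(x_\alpha)_{\alpha\in\Gamma}$ in a vector lattice $X$ converges in order to $x\in X$, written $x_\alpha\xrightarrow{\mathrm{o}}x$, if there is another net $(a_\gamma)_{\gamma\in\Lambda}$ in $X$ (possibly with a different index set) with $a_\gamma\downarrow 0$ such that for every $\gamma\in\Lambda$ there exists $\alpha_0\in\Gamma$ with $|x_\alpha-x|\le a_\gamma$ for all $\alpha\ge\alpha_0$. The net uo-converges (converges in unbounded order) to $x$, written $x_\alpha\xrightarrow{\mathrm{uo}}x$, if $|x_\alpha-x|\wedge y\xrightarrow{\mathrm{o}}0$ for every $y\in X_+$. The net $(x_\alpha)$ is uo-Cauchy in $X$ if the doubly indexed net $(x_\alpha-x_{\alpha'})_{(\alpha,\alpha')\in\Gamma\times\Gamma}$ (with $\Gamma\times\Gamma$ directed coordinatewise) uo-converges to $0$ in $X$. A linear functional $f$ on $X$ is order continuous if $f(x_\alpha)\to 0$ whenever $x_\alpha\xrightarrow{\mathrm{o}}0$; $X_n^\sim$ denotes the collection of all order continuous functionals on $X$. It separates points of $X$ if for every $x\ne 0$ in $X$ there is $f\in X_n^\sim$ with $f(x)\neq 0$. A Banach lattice is order continuous if $\|x_\alpha\|\to 0$ for every net $x_\alpha\downarrow 0$. A net is positive increasing if $x_\alpha\ge 0$ for all $\alpha$ and $x_\alpha\le x_\beta$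 whenever $\alpha\le\beta$. *)

theory Defs
  imports "HOL-Analysis.Analysis" "HOL-Library.Lattice_Algebras" "HOL-Library.Lub_Glb"
begin

class vector_lattice = ordered_real_vector + lattice_ab_group_add_abs

class banach_lattice = banach + vector_lattice +
  assumes norm_mono: "\<bar>x\<bar> \<le> \<bar>y\<bar> \<Longrightarrow> norm x \<le> norm y"

text \<open>
  A net is a family \<open>x :: 'i \<Rightarrow> 'a\<close> restricted to an index set \<open>\<Gamma>\<close> that is directed by a
  preorder \<open>r\<close>, where \<open>(\<alpha>, \<beta>) \<in> r\<close> means \<open>\<alpha> \<le> \<beta>\<close>.
\<close>

definition directed_on :: "'i set \<Rightarrow> 'i rel \<Rightarrow> bool" where
  "directed_on \<Gamma> r \<longleftrightarrow> \<Gamma> \<noteq> {} \<and> preorder_on \<Gamma> r \<and>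
     (\<forall>\<alpha>\<in>\<Gamma>. \<forall>\<beta>\<in>\<Gamma>. \<exists>\<gamma>\<in>\<Gamma>. (\<alpha>, \<gamma>) \<in> r \<and> (\<beta>, \<gamma>) \<in> r)"

definition net_filter :: "'i set \<Rightarrow> 'i rel \<Rightarrow> 'i filter" where
  "net_filter \<Gamma> r = (INF \<alpha>\<in>\<Gamma>. principal {\<beta>\<in>\<Gamma>. (\<alpha>, \<beta>) \<in> r})"

definition coordinatewise :: "'i rel \<Rightarrow> ('i \<times> 'i) rel" where
  "coordinatewise r = {((\<alpha>, \<alpha>'), (\<beta>, \<beta>')). (\<alpha>, \<beta>) \<in> r \<and> (\<alpha>', \<beta>') \<in> r}"

definition increasing_net :: "'i set \<Rightarrow> 'i rel \<Rightarrow> ('i \<Rightarrow> 'a::order) \<Rightarrow> bool" where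
  "increasing_net \<Gamma> r x \<longleftrightarrow> (\<forall>\<alpha>\<in>\<Gamma>. \<forall>\<beta>\<in>\<Gamma>. (\<alpha>, \<beta>) \<in> r \<longrightarrow> x \<alpha> \<le> x \<beta>)"

definition decreases_to_0 :: "'i set \<Rightarrow> 'i rel \<Rightarrow> ('i \<Rightarrow> 'a::vector_lattice) \<Rightarrow> bool" where
  "decreases_to_0 \<Gamma> r a \<longleftrightarrow>
     (\<forall>\<alpha>\<in>\<Gamma>. \<forall>\<beta>\<in>\<Gamma>. (\<alpha>, \<beta>) \<in> r \<longrightarrow> a \<beta> \<le> a \<alpha>) \<and> isGlb UNIV (a ` \<Gamma>) 0"

text \<open>
  HOL does not allow quantification over the type of an index set inside a definition. The
  definitions below that quantify over auxiliary nets take the index sets of these nets in the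
  type \<open>'a\<close> of the vector lattice itself. This loses nothing: the lemmas
  \<open>order_converges_any_index\<close>, \<open>order_continuous_dual_any_index\<close> and
  \<open>order_continuous_norm_any_index\<close> allow arbitrary index types.
\<close>

definition order_converges ::
  "'i set \<Rightarrow> 'i rel \<Rightarrow> ('i \<Rightarrow> 'a::vector_lattice) \<Rightarrow> 'a \<Rightarrow> bool" where
  "order_converges \<Gamma> r x l \<longleftrightarrow>
     (\<exists>(\<Lambda> :: 'a set) s a. directed_on \<Lambda> s \<and> decreases_to_0 \<Lambda> s a \<and>
        (\<forall>\<gamma>\<in>\<Lambda>. \<exists>\<alpha>\<^sub>0\<in>\<Gamma>. \<forall>\<alpha>\<in>\<Gamma>. (\<alpha>\<^sub>0, \<alpha>) \<in> r \<longrightarrow> \<bar>x \<alpha> - l\<bar> \<le> a \<gamma>))"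

definition uo_converges ::
  "'i set \<Rightarrow> 'i rel \<Rightarrow> ('i \<Rightarrow> 'a::vector_lattice) \<Rightarrow> 'a \<Rightarrow> bool" where
  "uo_converges \<Gamma> r x l \<longleftrightarrow> (\<forall>y\<ge>0. order_converges \<Gamma> r (\<lambda>\<alpha>. inf \<bar>x \<alpha> - l\<bar> y) 0)"

definition uo_Cauchy :: "'i set \<Rightarrow> 'i rel \<Rightarrow> ('i \<Rightarrow> 'a::vector_lattice) \<Rightarrow> bool" where
  "uo_Cauchy \<Gamma> r x \<longleftrightarrow>
     uo_converges (\<Gamma> \<times> \<Gamma>) (coordinatewise r) (\<lambda>(\<alpha>, \<alpha>'). x \<alpha> - x \<alpha>') 0"

definition order_continuous_dual :: "('a::vector_lattice \<Rightarrow> real) set" where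
  "order_continuous_dual = {f. linear f \<and>
     (\<forall>(\<Gamma> :: 'a set) r x. directed_on \<Gamma> r \<longrightarrow> order_converges \<Gamma> r x 0 \<longrightarrow>
        ((\<lambda>\<alpha>. f (x \<alpha>)) \<longlongrightarrow> 0) (net_filter \<Gamma> r))}"

definition separates_points :: "('a::zero \<Rightarrow> real) set \<Rightarrow> bool" where
  "separates_points F \<longleftrightarrow> (\<forall>x. x \<noteq> 0 \<longrightarrow> (\<exists>f\<in>F. f x \<noteq> 0))"

definition order_continuous_norm :: "'a::banach_lattice itself \<Rightarrow> bool" where
  "order_continuous_norm _ \<longleftrightarrow>
     (\<forall>(\<Gamma> :: 'a set) r (x :: 'a \<Rightarrow> 'a). directed_on \<Gamma> r \<longrightarrow> decreases_to_0 \<Gamma> r x \<longrightarrow>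
        ((\<lambda>\<alpha>. norm (x \<alpha>)) \<longlongrightarrow> 0) (net_filter \<Gamma> r))"


lemma eventually_net_filter:
  assumes "directed_on \<Gamma> r"
  shows "eventually P (net_filter \<Gamma> r) \<longleftrightarrow> (\<exists>\<alpha>\<^sub>0\<in>\<Gamma>. \<forall>\<alpha>\<in>\<Gamma>. (\<alpha>\<^sub>0, \<alpha>) \<in> r \<longrightarrow> P \<alpha>)"
proof -
  have tr: "trans r" and ne: "\<Gamma> \<noteq> {}"
    using assms by (auto simp: directed_on_def preorder_on_def)
  have "\<exists>c\<in>\<Gamma>. principal {\<beta>\<in>\<Gamma>. (c, \<beta>) \<in> r} \<le>
      inf (principal {\<beta>\<in>\<Gamma>. (a, \<beta>) \<in> r}) (principal {\<beta>\<in>\<Gamma>. (b, \<beta>) \<in> r})"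
    if ab: "a \<in> \<Gamma>" "b \<in> \<Gamma>" for a b
  proof -
    obtain c where c: "c \<in> \<Gamma>" "(a, c) \<in> r" "(b, c) \<in> r"
      using assms ab unfolding directed_on_def by blast
    show ?thesis
      by (rule bexI[OF _ c(1)]) (use c(2,3) tr in \<open>auto dest: transD\<close>)
  qed
  then show ?thesis
    unfolding net_filter_def
    by (subst eventually_INF_base[OF ne]) (auto simp: eventually_principal)
qed

lemma directed_on_image:
  fixes a :: "'k \<Rightarrow> 'a::vector_lattice"
  assumes "directed_on \<Lambda> s" "decreases_to_0 \<Lambda> s a"
  defines "s' \<equiv> {(u, v). u \<in> a ` \<Lambda> \<and> v \<in> a ` \<Lambda> \<and> v \<le> u}"
  shows "directed_on (a ` \<Lambda>) s'" "decreases_to_0 (a ` \<Lambda>) s' (\<lambda>u. u)"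
proof -
  show "directed_on (a ` \<Lambda>) s'"
    unfolding directed_on_def
  proof (intro conjI ballI)
    show "a ` \<Lambda> \<noteq> {}" using assms(1) by (auto simp: directed_on_def)
    show "preorder_on (a ` \<Lambda>) s'"
      by (auto simp: preorder_on_def s'_def intro!: refl_onI transI)
    fix u v assume "u \<in> a ` \<Lambda>" "v \<in> a ` \<Lambda>"
    then obtain i j where ij: "i \<in> \<Lambda>" "u = a i" "j \<in> \<Lambda>" "v = a j" by auto
    then obtain k where "k \<in> \<Lambda>" "(i, k) \<in> s" "(j, k) \<in> s"
      using assms(1) unfolding directed_on_def by blast
    then show "\<exists>w\<in>a ` \<Lambda>. (u, w) \<in> s' \<and> (v, w) \<in> s'"
      using assms(2) ij by (auto simp: s'_def decreases_to_0_def)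
  qed
  show "decreases_to_0 (a ` \<Lambda>) s' (\<lambda>u. u)"
    using assms(2) by (auto simp: decreases_to_0_def s'_def)
qed

lemma order_converges_any_index:
  fixes a :: "'k \<Rightarrow> 'a::vector_lattice"
  assumes "directed_on \<Lambda> s" "decreases_to_0 \<Lambda> s a"
    and "\<forall>\<gamma>\<in>\<Lambda>. \<exists>\<alpha>\<^sub>0\<in>\<Gamma>. \<forall>\<alpha>\<in>\<Gamma>. (\<alpha>\<^sub>0, \<alpha>) \<in> r \<longrightarrow> \<bar>x \<alpha> - l\<bar> \<le> a \<gamma>"
  shows "order_converges \<Gamma> r x l"
  unfolding order_converges_def
  by (rule exI, rule exI, rule exI, intro conjI, rule directed_on_image(1)[OF assms(1,2)],
      rule directed_on_image(2)[OF assms(1,2)]) (use assms(3) in auto)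

lemma order_continuous_dual_any_index:
  fixes x :: "'i \<Rightarrow> 'a::vector_lattice"
  assumes f: "f \<in> order_continuous_dual" and dir: "directed_on \<Gamma> r"
    and conv: "order_converges \<Gamma> r x 0"
  shows "((\<lambda>\<alpha>. f (x \<alpha>)) \<longlongrightarrow> 0) (net_filter \<Gamma> r)"
proof (rule ccontr)
  assume "\<not> ?thesis"
  then obtain e where e: "e > 0"
    and bad: "\<And>\<alpha>\<^sub>0. \<alpha>\<^sub>0 \<in> \<Gamma> \<Longrightarrow> \<exists>\<alpha>\<in>\<Gamma>. (\<alpha>\<^sub>0, \<alpha>) \<in> r \<and> \<not> \<bar>f (x \<alpha>)\<bar> < e"
    unfolding tendsto_iff eventually_net_filter[OF dir] by (auto simp: dist_real_def)
  obtain \<Lambda> :: "'a set" and s a where dir': "directed_on \<Lambda> s" and a: "decreases_to_0 \<Lambda> s a"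
    and dom: "\<And>\<gamma>. \<gamma> \<in> \<Lambda> \<Longrightarrow> \<exists>\<alpha>\<^sub>0\<in>\<Gamma>. \<forall>\<alpha>\<in>\<Gamma>. (\<alpha>\<^sub>0, \<alpha>) \<in> r \<longrightarrow> \<bar>x \<alpha> - 0\<bar> \<le> a \<gamma>"
    using conv unfolding order_converges_def by blast
  have "\<exists>\<alpha>\<in>\<Gamma>. \<bar>x \<alpha>\<bar> \<le> a \<gamma> \<and> \<not> \<bar>f (x \<alpha>)\<bar> < e" if "\<gamma> \<in> \<Lambda>" for \<gamma>
    using dom[OF that] bad by fastforce
  then obtain c where c: "\<And>\<gamma>. \<gamma> \<in> \<Lambda> \<Longrightarrow> \<bar>x (c \<gamma>)\<bar> \<le> a \<gamma> \<and> \<not> \<bar>f (x (c \<gamma>))\<bar> < e"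
    by metis
  have "order_converges \<Lambda> s (\<lambda>\<gamma>. x (c \<gamma>)) 0"
  proof (rule order_converges_any_index[OF dir' a], intro ballI)
    fix \<gamma> assume g: "\<gamma> \<in> \<Lambda>"
    have "\<bar>x (c \<delta>) - 0\<bar> \<le> a \<gamma>" if "\<delta> \<in> \<Lambda>" "(\<gamma>, \<delta>) \<in> s" for \<delta>
      using c[OF that(1)] a g that unfolding decreases_to_0_def by force
    then show "\<exists>\<alpha>\<^sub>0\<in>\<Lambda>. \<forall>\<alpha>\<in>\<Lambda>. (\<alpha>\<^sub>0, \<alpha>) \<in> s \<longrightarrow> \<bar>x (c \<alpha>) - 0\<bar> \<le> a \<gamma>"
      using g by blast
  qed
  then have "((\<lambda>\<gamma>. f (x (c \<gamma>))) \<longlongrightarrow> 0) (net_filter \<Lambda> s)"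
    using f dir' unfolding order_continuous_dual_def by blast
  then obtain d where d: "d \<in> \<Lambda>" "\<And>\<gamma>. \<gamma> \<in> \<Lambda> \<Longrightarrow> (d, \<gamma>) \<in> s \<Longrightarrow> \<bar>f (x (c \<gamma>))\<bar> < e"
    using e unfolding tendsto_iff eventually_net_filter[OF dir'] by (auto simp: dist_real_def)
  moreover have "(d, d) \<in> s"
    using dir' d(1) by (auto simp: directed_on_def preorder_on_def refl_on_def)
  ultimately show False using c by blast
qed

lemma order_continuous_norm_any_index:
  fixes x :: "'i \<Rightarrow> 'a::banach_lattice"
  assumes oc: "order_continuous_norm TYPE('a)" and dir: "directed_on \<Gamma> r"
    and x: "decreases_to_0 \<Gamma> r x"
  shows "((\<lambda>\<alpha>. norm (x \<alpha>)) \<longlongrightarrow> 0) (net_filter \<Gamma> r)"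
proof -
  define s where "s = {(u, v). u \<in> x ` \<Gamma> \<and> v \<in> x ` \<Gamma> \<and> v \<le> u}"
  have dir': "directed_on (x ` \<Gamma>) s" and x': "decreases_to_0 (x ` \<Gamma>) s (\<lambda>u. u)"
    using directed_on_image[OF dir x] by (simp_all add: s_def)
  then have "((\<lambda>u. norm u) \<longlongrightarrow> 0) (net_filter (x ` \<Gamma>) s)"
    using oc unfolding order_continuous_norm_def by blast
  then show ?thesis
    using x unfolding tendsto_iff eventually_net_filter[OF dir'] eventually_net_filter[OF dir]
    by (fastforce simp: s_def decreases_to_0_def)
qed

end

theory Submission
  imports Defs
begin

text \<open>
  \<^emph>\<open>Separation of points.\<close> If the norm is order continuous, then every norm continuous functional
  is order continuous, because an order null net is eventually dominated by elements of
  arbitrarily small norm (\<open>bounded_linear_in_order_continuous_dual\<close>). Hence it suffices that the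
  norm continuous functionals separate points, which is the Hahn--Banach theorem. It is proved
  here by means of minimal sublinear functionals (\<open>exists_linear_below_sublinear\<close>).

  \<^emph>\<open>Increasing nets.\<close> Fix \<open>y \<ge> 0\<close>. The net of the \<open>inf \<bar>x \<alpha> - x \<beta>\<bar> y\<close> converges in order to \<open>0\<close>
  as soon as the set of its eventual upper bounds has infimum \<open>0\<close>
  (\<open>order_converges_if_isGlb_eventual_bounds\<close>). For \<open>\<alpha>, \<beta>\<close> beyond \<open>\<alpha>\<^sub>0\<close> and \<open>\<gamma>\<close> beyond both,
  \<open>\<bar>x \<alpha> - x \<beta>\<bar> \<le> x \<gamma> - x \<alpha>\<^sub>0\<close>. Therefore each upper bound of the increasing net
  \<open>d \<gamma> = inf (sup (x \<gamma> - x \<alpha>\<^sub>0) 0) y\<close> is an eventual upper bound. Let \<open>z \<ge> 0\<close> lie below all eventual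
  upper bounds. Every order continuous functional \<open>f\<close> satisfies \<open>f z \<le> 0\<close>; applied to \<open>- f\<close> as
  well this gives \<open>f z = 0\<close>, and \<open>z = 0\<close> by separation. The inequality rests on two facts.

  \<^item> Although \<open>d\<close> need not have a supremum, \<open>inf (d \<gamma>) z\<close> increases to \<open>z\<close>, by an Archimedean
    argument (\<open>decreases_to_0_meet_increasing_net\<close>). Hence \<open>f (inf (d \<gamma>) z)\<close> tends to \<open>f z\<close>.

  \<^item> The functional \<open>f\<close> is norm bounded (\<open>order_continuous_dual_bounded_linear\<close>), so
    \<open>g a = Sup (f ` {0..a})\<close> is bounded along the net. As \<open>g\<close> is superadditive on positive elements,
    \<open>\<alpha>\<^sub>0\<close> can be chosen with \<open>g (x \<gamma> - x \<alpha>\<^sub>0) \<le> e\<close> for all \<open>\<gamma>\<close> beyond \<open>\<alpha>\<^sub>0\<close>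
    (\<open>functional_small_on_increments\<close>). Then \<open>f (inf (d \<gamma>) z) \<le> e\<close>.
\<close>

section \<open>Sublinear functionals and the separation of points by bounded functionals\<close>

definition sublinear :: "('a::real_vector \<Rightarrow> real) \<Rightarrow> bool" where
  "sublinear q \<longleftrightarrow> (\<forall>a b. q (a + b) \<le> q a + q b) \<and> (\<forall>c>0. \<forall>a. q (c *\<^sub>R a) = c * q a)"

lemma sublinearI:
  assumes "\<And>a b. q (a + b) \<le> q a + q b" "\<And>c a. c > 0 \<Longrightarrow> q (c *\<^sub>R a) \<le> c * q a"
  shows "sublinear q"
  unfolding sublinear_def
proof (intro conjI allI impI antisym)
  fix c :: real and a
  assume c: "c > 0"
  have "q a \<le> (1 / c) * q (c *\<^sub>R a)"
    using assms(2)[of "1 / c" "c *\<^sub>R a"] c by simp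
  then show "c * q a \<le> q (c *\<^sub>R a)"
    using c by (simp add: field_simps)
qed (use assms in auto)

lemma sublinear_add: "sublinear q \<Longrightarrow> q (a + b) \<le> q a + q b"
  by (simp add: sublinear_def)

lemma sublinear_0: "sublinear q \<Longrightarrow> q 0 = 0"
  unfolding sublinear_def by (metis add_cancel_right_right mult_2 scaleR_zero_right zero_less_numeral)

lemma sublinear_scale: "sublinear q \<Longrightarrow> c \<ge> 0 \<Longrightarrow> q (c *\<^sub>R a) = c * q a"
  using sublinear_0[of q] by (cases "c = 0") (auto simp: sublinear_def)

lemma sublinear_lower: "sublinear q \<Longrightarrow> - q (- a) \<le> q a"
  using sublinear_add[of q a "- a"] sublinear_0[of q] by simp

text \<open>
  This is the auxiliary functional of the Hahn--Banach theorem: a sublinear functional below \<open>q\<close>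
  that becomes additive in the direction \<open>x\<close>, in the sense that its value at \<open>- x\<close> is at most
  \<open>- q x\<close>. It serves twice: a minimal \<open>q\<close> equals all of its straightenings and is therefore linear,
  and a linear functional below the straightening of the norm at \<open>x\<close> does not vanish at \<open>x\<close>.
\<close>

definition straighten :: "('a::real_vector \<Rightarrow> real) \<Rightarrow> 'a \<Rightarrow> 'a \<Rightarrow> real" where
  "straighten q x y = (INF t\<in>{0..}. q (y + t *\<^sub>R x) - t * q x)"

lemma straighten_le:
  assumes "sublinear q" "t \<ge> 0"
  shows "straighten q x y \<le> q (y + t *\<^sub>R x) - t * q x"
  unfolding straighten_def
proof (rule cINF_lower)
  show "bdd_below ((\<lambda>t. q (y + t *\<^sub>R x) - t * q x) ` {0..})"
  proof (rule bdd_belowI2)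
    fix t :: real assume "t \<in> {0..}"
    \<comment> \<open>From \<open>t * q x = q (t *\<^sub>R x) \<le> q (y + t *\<^sub>R x) + q (- y)\<close>.\<close>
    then show "- q (- y) \<le> q (y + t *\<^sub>R x) - t * q x"
      using sublinear_add[OF assms(1), of "y + t *\<^sub>R x" "- y"] sublinear_scale[OF assms(1), of t x]
      by simp
  qed
qed (use assms in auto)

lemma straighten_le_self: "sublinear q \<Longrightarrow> straighten q x y \<le> q y"
  using straighten_le[of q 0 x y] by simp

lemma straighten_minus_le: "sublinear q \<Longrightarrow> straighten q x (- x) \<le> - q x"
  using straighten_le[of q 1 x "- x"] sublinear_0[of q] by simp

lemma sublinear_straighten:
  assumes q: "sublinear q"
  shows "sublinear (straighten q x)"
proof (rule sublinearI)
  fix a b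
  have *: "straighten q x (a + b) \<le> (q (a + s *\<^sub>R x) - s * q x) + (q (b + t *\<^sub>R x) - t * q x)"
    if "s \<ge> 0" "t \<ge> 0" for s t
  proof -
    have "straighten q x (a + b) \<le> q ((a + b) + (s + t) *\<^sub>R x) - (s + t) * q x"
      using that by (intro straighten_le[OF q]) auto
    also have "(a + b) + (s + t) *\<^sub>R x = (a + s *\<^sub>R x) + (b + t *\<^sub>R x)"
      by (simp add: algebra_simps)
    finally show ?thesis
      using sublinear_add[OF q, of "a + s *\<^sub>R x" "b + t *\<^sub>R x"] by (simp add: algebra_simps)
  qed
  have "straighten q x (a + b) - (q (a + s *\<^sub>R x) - s * q x) \<le> straighten q x b"
    if "s \<ge> 0" for s
    unfolding straighten_def[of q x b]
  proof (rule cINF_greatest)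
    fix t :: real assume "t \<in> {0..}"
    then show "straighten q x (a + b) - (q (a + s *\<^sub>R x) - s * q x) \<le> q (b + t *\<^sub>R x) - t * q x"
      using *[of s t] that by simp
  qed simp
  then have "straighten q x (a + b) - straighten q x b \<le> straighten q x a"
    unfolding straighten_def[of q x a] by (intro cINF_greatest) (auto simp: algebra_simps)
  then show "straighten q x (a + b) \<le> straighten q x a + straighten q x b" by simp
next
  fix c :: real and a
  assume c: "c > 0"
  have "straighten q x (c *\<^sub>R a) / c \<le> straighten q x a"
    unfolding straighten_def[of q x a]
  proof (rule cINF_greatest)
    fix t :: real assume t: "t \<in> {0..}"
    have "straighten q x (c *\<^sub>R a) \<le> q (c *\<^sub>R a + (c * t) *\<^sub>R x) - c * t * q x"
      using t c by (intro straighten_le[OF q]) auto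
    also have "c *\<^sub>R a + (c * t) *\<^sub>R x = c *\<^sub>R (a + t *\<^sub>R x)"
      by (simp add: algebra_simps)
    also have "q \<dots> - c * t * q x = c * (q (a + t *\<^sub>R x) - t * q x)"
      using c by (simp only: sublinear_scale[OF q] less_imp_le) (simp add: right_diff_distrib)
    finally show "straighten q x (c *\<^sub>R a) / c \<le> q (a + t *\<^sub>R x) - t * q x"
      using c by (simp add: field_simps)
  qed simp
  then show "straighten q x (c *\<^sub>R a) \<le> c * straighten q x a"
    using c by (simp add: field_simps)
qed

text \<open>
  For subadditivity of the pointwise infimum two members of the chain must be compared, and the
  smaller one bounds both values. All members lie between \<open>\<lambda>y. - p (- y)\<close> and \<open>p\<close>, so the infimum is
  finite.
\<close>

lemma sublinear_INF_chain:
  assumes ne: "C \<noteq> {}" and sub: "\<And>q. q \<in> C \<Longrightarrow> sublinear q \<and> q \<le> p"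
    and chain: "\<And>q r. q \<in> C \<Longrightarrow> r \<in> C \<Longrightarrow> q \<le> r \<or> r \<le> q"
  shows "sublinear (\<lambda>y. INF q\<in>C. q y)" and "\<And>q. q \<in> C \<Longrightarrow> (\<lambda>y. INF q\<in>C. q y) \<le> q"
proof -
  have bdd: "bdd_below ((\<lambda>q. q y) ` C)" for y
  proof (rule bdd_belowI2)
    fix q assume q: "q \<in> C"
    then have "- p (- y) \<le> - q (- y)" using sub by (auto simp: le_fun_def)
    also have "\<dots> \<le> q y" using sublinear_lower sub[OF q] by blast
    finally show "- p (- y) \<le> q y" .
  qed
  let ?m = "\<lambda>y. INF q\<in>C. q y"
  have low: "?m y \<le> q y" if "q \<in> C" for q y
    by (rule cINF_lower[OF bdd that])
  then show "\<And>q. q \<in> C \<Longrightarrow> ?m \<le> q" by (auto simp: le_fun_def)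
  show "sublinear ?m"
  proof (rule sublinearI)
    fix a b
    have *: "?m (a + b) \<le> q a + r b" if qr: "q \<in> C" "r \<in> C" for q r
      using chain[OF qr]
    proof
      assume "q \<le> r"
      then show ?thesis
        using low[OF qr(1), of "a + b"] sublinear_add[of q a b] sub[OF qr(1)]
        by (force simp: le_fun_def intro: order_trans)
    next
      assume "r \<le> q"
      then show ?thesis
        using low[OF qr(2), of "a + b"] sublinear_add[of r a b] sub[OF qr(2)]
        by (force simp: le_fun_def intro: order_trans)
    qed
    have "?m (a + b) - q a \<le> ?m b" if "q \<in> C" for q
      using *[OF that] by (intro cINF_greatest[OF ne]) (auto simp: algebra_simps)
    then have "?m (a + b) - ?m b \<le> ?m a"
      by (intro cINF_greatest[OF ne]) (auto simp: algebra_simps)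
    then show "?m (a + b) \<le> ?m a + ?m b" by simp
  next
    fix c :: real and a assume c: "c > 0"
    have "?m (c *\<^sub>R a) / c \<le> ?m a"
    proof (rule cINF_greatest[OF ne])
      fix q assume q: "q \<in> C"
      then show "?m (c *\<^sub>R a) / c \<le> q a"
        using low[OF q, of "c *\<^sub>R a"] sublinear_scale[of q c a] sub[OF q] c
        by (simp add: field_simps)
    qed
    then show "?m (c *\<^sub>R a) \<le> c * ?m a" using c by (simp add: field_simps)
  qed
qed

lemma linear_if_minimal_sublinear:
  assumes q: "sublinear q" and min: "\<And>r. sublinear r \<Longrightarrow> r \<le> q \<Longrightarrow> r = q"
  shows "linear q"
proof -
  have eq: "straighten q x = q" for x
    using straighten_le_self[OF q] by (intro min sublinear_straighten[OF q]) (auto simp: le_fun_def)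
  have neg: "q (- x) = - q x" for x
    using straighten_minus_le[OF q, of x] sublinear_lower[OF q, of x] eq[of x] by simp
  show ?thesis
  proof (rule linearI)
    fix a b
    show "q (a + b) = q a + q b"
      using sublinear_add[OF q, of a b] sublinear_add[OF q, of "a + b" "- b"] neg[of b] by simp
  next
    fix c a
    show "q (c *\<^sub>R a) = c *\<^sub>R q a"
      using sublinear_scale[OF q, of c a] sublinear_scale[OF q, of "- c" a] neg[of "c *\<^sub>R a"]
      by (cases "c \<ge> 0") auto
  qed
qed

text \<open>
  Zorn's lemma is applied to total sublinear functionals in decreasing order instead of
  to linear functionals on subspaces, so that no partial functions have to be handled.
\<close>

theorem exists_linear_below_sublinear:
  fixes p :: "'a::real_vector \<Rightarrow> real"
  assumes p: "sublinear p"
  obtains f where "linear f" "f \<le> p"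
proof -
  let ?A = "{q. sublinear q \<and> q \<le> p}"
  have "\<exists>m\<in>?A. \<forall>a\<in>?A. m \<ge> a \<longrightarrow> a = m"
  proof (rule predicate_Zorn)
    show "partial_order_on ?A (relation_of (\<lambda>q r. q \<ge> r) ?A)"
      by (rule partial_order_on_relation_ofI) auto
    fix C assume C: "C \<in> Chains (relation_of (\<lambda>q r. q \<ge> r) ?A)"
    show "\<exists>u\<in>?A. \<forall>a\<in>C. a \<ge> u"
    proof (cases "C = {}")
      case False
      then obtain q where q: "q \<in> C" by auto
      have sub: "\<And>q. q \<in> C \<Longrightarrow> sublinear q \<and> q \<le> p"
        and chain: "\<And>q r. q \<in> C \<Longrightarrow> r \<in> C \<Longrightarrow> q \<le> r \<or> r \<le> q"
        using C by (auto simp: Chains_def relation_of_def)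
      let ?m = "\<lambda>y. INF q\<in>C. q y"
      have "sublinear ?m"
        by (rule sublinear_INF_chain(1)[OF False]) (use sub chain in blast)+
      moreover have le: "?m \<le> q" if "q \<in> C" for q
        by (rule sublinear_INF_chain(2)[OF False _ _ that]) (use sub chain in blast)+
      moreover have "?m \<le> p"
        using le[OF q] sub[OF q] by (meson order_trans)
      ultimately show ?thesis by blast
    qed (use p in auto)
  qed
  then obtain m where m: "sublinear m" "m \<le> p" "\<And>a. sublinear a \<Longrightarrow> a \<le> p \<Longrightarrow> a \<le> m \<Longrightarrow> a = m"
    by blast
  have "linear m"
    using m by (intro linear_if_minimal_sublinear) (auto intro: order_trans)
  then show ?thesis using m(2) that by blast
qed

corollary bounded_functional_nonzero_at:
  fixes x :: "'a::real_normed_vector"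
  assumes "x \<noteq> 0"
  obtains f :: "'a \<Rightarrow> real" where "bounded_linear f" "f x \<noteq> 0"
proof -
  have n: "sublinear (norm :: 'a \<Rightarrow> real)"
    by (auto simp: sublinear_def norm_triangle_ineq)
  obtain f where f: "linear f" "f \<le> straighten norm x"
    using exists_linear_below_sublinear[OF sublinear_straighten[OF n]] by blast
  have le: "f y \<le> norm y" for y
    using f(2) straighten_le_self[OF n, of x y] by (meson le_fun_def order_trans)
  have "\<bar>f y\<bar> \<le> norm y" for y
    using le[of y] le[of "- y"] linear_neg[OF f(1), of y] by simp
  then have "bounded_linear f"
    using f(1) by (intro bounded_linear_intro[where K = 1]) (auto simp: linear_add linear_scale)
  moreover have "f (- x) \<le> - norm x"
    using f(2) straighten_minus_le[OF n, of x] by (meson le_fun_def order_trans)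
  then have "f x \<noteq> 0" using linear_neg[OF f(1), of x] assms by auto
  ultimately show ?thesis using that by blast
qed

section \<open>Order and norm in a Banach lattice\<close>

lemma isGlb_iff:
  fixes l :: "'a::order"
  shows "isGlb UNIV S l \<longleftrightarrow> (\<forall>s\<in>S. l \<le> s) \<and> (\<forall>t. (\<forall>s\<in>S. t \<le> s) \<longrightarrow> t \<le> l)"
  by (auto simp: isGlb_def greatestP_def isLb_def setle_def setge_def)

lemma norm_abs_lattice: "norm \<bar>a\<bar> = norm (a::'a::banach_lattice)"
  by (intro antisym norm_mono) simp_all

lemma norm_mono_abs_le:
  fixes a b :: "'a::banach_lattice"
  assumes "\<bar>a\<bar> \<le> b"
  shows "norm a \<le> norm b"
  using norm_mono[of a b] order_trans[OF assms abs_ge_self] by blast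

text \<open>
  The Archimedean property comes from the norm: \<open>real n * norm a \<le> norm u\<close> for all \<open>n\<close>.
\<close>

lemma archimedean_banach_lattice:
  fixes a u :: "'a::banach_lattice"
  assumes "0 \<le> a" and le: "\<And>n. real n *\<^sub>R a \<le> u"
  shows "a = 0"
proof (rule ccontr)
  assume "a \<noteq> 0"
  then obtain n where n: "norm u < real n * norm a"
    using reals_Archimedean3[of "norm a"] by auto
  have "norm (real n *\<^sub>R a) \<le> norm u"
    using assms le[of n] by (intro norm_mono_abs_le) (simp add: scaleR_nonneg_nonneg)
  then show False using n by simp
qed

text \<open>
  Order intervals are norm closed because the positive part of \<open>c - l\<close> is dominated by
  \<open>\<bar>s n - l\<bar>\<close>.
\<close>

lemma limit_ge_banach_lattice:
  fixes s :: "nat \<Rightarrow> 'a::banach_lattice"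
  assumes lim: "s \<longlonglongrightarrow> l" and ge: "\<And>n. n \<ge> N \<Longrightarrow> c \<le> s n"
  shows "c \<le> l"
proof -
  have "norm (sup (c - l) 0) \<le> norm (s n - l)" if "n \<ge> N" for n
  proof -
    have "c - l \<le> \<bar>s n - l\<bar>"
      using ge[OF that] by (meson abs_ge_self diff_right_mono order_trans)
    then have "\<bar>sup (c - l) 0\<bar> \<le> \<bar>s n - l\<bar>"
      by (subst abs_of_nonneg) auto
    then show ?thesis by (rule norm_mono)
  qed
  moreover have "(\<lambda>n. norm (s n - l)) \<longlonglongrightarrow> 0"
    using lim by (simp add: LIM_zero tendsto_norm_zero)
  ultimately have "norm (sup (c - l) 0) \<le> 0"
    by (meson LIMSEQ_le_const)
  then have "c - l \<le> 0" by (metis norm_le_zero_iff sup.cobounded1)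
  then show ?thesis by simp
qed

lemma term_le_suminf_banach_lattice:
  fixes t :: "nat \<Rightarrow> 'a::banach_lattice"
  assumes "summable t" "\<And>n. 0 \<le> t n"
  shows "t n \<le> suminf t"
proof (rule limit_ge_banach_lattice[OF summable_LIMSEQ[OF assms(1)]])
  fix k assume "k \<ge> Suc n"
  then show "t n \<le> sum t {..<k}"
    using sum_mono2[of "{..<k}" "{n}" t] assms(2) by auto
qed

section \<open>Order continuous functionals\<close>

lemma directed_on_nat: "directed_on UNIV {(m::nat, n). m \<le> n}"
  by (auto simp: directed_on_def preorder_on_def refl_on_def trans_def) (meson le_add1 le_add2)

text \<open>
  A sequence that stays below \<open>u\<close> even after multiplication by \<open>n + 1\<close> is dominated by
  \<open>(1 / (n + 1)) *\<^sub>R u\<close>, which decreases to \<open>0\<close> by the Archimedean property.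
\<close>

lemma order_converges_seq_0:
  fixes w :: "nat \<Rightarrow> 'a::banach_lattice"
  assumes w: "\<And>n. real (Suc n) *\<^sub>R \<bar>w n\<bar> \<le> u"
  shows "order_converges UNIV {(m, n). m \<le> n} w 0"
proof -
  have u: "0 \<le> u" using order_trans[OF abs_ge_zero[of "w 0"], of u] w[of 0] by simp
  define a where "a n = (1 / real (Suc n)) *\<^sub>R u" for n
  have dec: "a n \<le> a m" if "m \<le> n" for m n
    unfolding a_def using that u by (intro scaleR_right_mono) (auto simp: field_simps)
  show ?thesis
  proof (rule order_converges_any_index)
    show "directed_on UNIV {(m::nat, n). m \<le> n}" by (rule directed_on_nat)
    have "t \<le> 0" if t: "\<forall>s\<in>range a. t \<le> s" for t
    proof -
      have "real n *\<^sub>R sup t 0 \<le> u" for n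
      proof -
        have "sup t 0 \<le> a n"
          using t u by (auto simp: a_def scaleR_nonneg_nonneg)
        then have "real (Suc n) *\<^sub>R sup t 0 \<le> real (Suc n) *\<^sub>R a n"
          by (rule scaleR_left_mono) simp
        then have "real (Suc n) *\<^sub>R sup t 0 \<le> u" by (simp add: a_def)
        moreover have "real n *\<^sub>R sup t 0 \<le> real (Suc n) *\<^sub>R sup t 0"
          by (rule scaleR_right_mono) auto
        ultimately show ?thesis by (rule order_trans[rotated])
      qed
      then have "sup t 0 = 0"
        by (intro archimedean_banach_lattice) auto
      then show ?thesis by (metis sup.cobounded1)
    qed
    then show "decreases_to_0 UNIV {(m, n). m \<le> n} a"
      using dec u by (auto simp: decreases_to_0_def isGlb_iff a_def scaleR_nonneg_nonneg)
    show "\<forall>\<gamma>\<in>UNIV. \<exists>\<alpha>\<^sub>0\<in>UNIV. \<forall>\<alpha>\<in>UNIV. (\<alpha>\<^sub>0, \<alpha>) \<in> {(m, n). m \<le> n} \<longrightarrow> \<bar>w \<alpha> - 0\<bar> \<le> a \<gamma>"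
    proof (intro ballI)
      fix n
      have "\<bar>w k\<bar> \<le> a n" if "n \<le> k" for k
      proof -
        have "(1 / real (Suc k)) *\<^sub>R (real (Suc k) *\<^sub>R \<bar>w k\<bar>) \<le> a k"
          unfolding a_def by (rule scaleR_left_mono[OF w]) simp
        then show ?thesis using dec[OF that] by simp
      qed
      then show "\<exists>\<alpha>\<^sub>0\<in>UNIV. \<forall>\<alpha>\<in>UNIV. (\<alpha>\<^sub>0, \<alpha>) \<in> {(m, n). m \<le> n} \<longrightarrow> \<bar>w \<alpha> - 0\<bar> \<le> a n"
        by auto
    qed
  qed
qed

text \<open>
  An unbounded functional takes values of modulus \<open>1\<close> on a sequence \<open>w\<close> whose norms decrease so
  quickly that \<open>u = (\<Sum>n. (n + 1) *\<^sub>R \<bar>w n\<bar>)\<close> exists. The factor \<open>n + 1\<close> makes \<open>w\<close> converge to \<open>0\<close> in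
  order, with \<open>u\<close> as regulator, and this contradicts order continuity.
\<close>

lemma order_continuous_dual_bounded_linear:
  fixes f :: "'a::banach_lattice \<Rightarrow> real"
  assumes f: "f \<in> order_continuous_dual"
  shows "bounded_linear f"
proof (rule ccontr)
  have lin: "linear f" using f by (simp add: order_continuous_dual_def)
  assume "\<not> bounded_linear f"
  then have unb: "\<exists>v. \<bar>f v\<bar> > norm v * K" for K
    using lin bounded_linear_intro[of f K] by (force simp: linear_add linear_scale not_less)
  have "\<forall>n. \<exists>w. \<bar>f w\<bar> = 1 \<and> real (Suc n) * norm w \<le> (1 / 2) ^ n"
  proof
    fix n
    obtain v where v: "\<bar>f v\<bar> > norm v * (real (Suc n) * 2 ^ n)" using unb by blast
    have pos: "\<bar>f v\<bar> > 0"
      by (rule order_le_less_trans[OF _ v]) simp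
    show "\<exists>w. \<bar>f w\<bar> = 1 \<and> real (Suc n) * norm w \<le> (1 / 2) ^ n"
      using v pos
      by (intro exI[of _ "(1 / \<bar>f v\<bar>) *\<^sub>R v"])
        (simp add: linear_scale[OF lin] abs_mult field_simps)
  qed
  then obtain w where w: "\<And>n. \<bar>f (w n)\<bar> = 1" "\<And>n. real (Suc n) * norm (w n) \<le> (1 / 2) ^ n"
    by metis
  define t where "t n = real (Suc n) *\<^sub>R \<bar>w n\<bar>" for n
  have "summable t"
  proof (rule summable_comparison_test')
    show "summable (\<lambda>n. (1 / 2 :: real) ^ n)" by (simp add: summable_geometric)
    show "norm (t n) \<le> (1 / 2) ^ n" for n
      using w(2)[of n] by (simp add: t_def norm_abs_lattice)
  qed
  then have "real (Suc n) *\<^sub>R \<bar>w n\<bar> \<le> suminf t" for n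
    using term_le_suminf_banach_lattice[of t n] by (simp add: t_def scaleR_nonneg_nonneg)
  then have "order_converges UNIV {(m, n). m \<le> n} w 0"
    by (rule order_converges_seq_0)
  then have "((\<lambda>n. f (w n)) \<longlongrightarrow> 0) (net_filter UNIV {(m, n). m \<le> n})"
    by (rule order_continuous_dual_any_index[OF f directed_on_nat])
  then have "\<forall>\<^sub>F n in net_filter UNIV {(m, n). m \<le> n}. \<bar>f (w n)\<bar> < 1"
    by (auto simp: tendsto_iff dist_real_def)
  then show False
    using w(1) by (auto simp: eventually_net_filter[OF directed_on_nat])
qed

lemma uminus_in_order_continuous_dual:
  fixes f :: "'a::vector_lattice \<Rightarrow> real"
  assumes f: "f \<in> order_continuous_dual"
  shows "(\<lambda>v. - f v) \<in> order_continuous_dual"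
  unfolding order_continuous_dual_def mem_Collect_eq
proof (intro conjI allI impI)
  show "linear (\<lambda>v. - f v)"
    using f by (intro linear_compose_neg) (simp add: order_continuous_dual_def)
  fix \<Gamma> :: "'a set" and r and x :: "'a \<Rightarrow> 'a"
  assume "directed_on \<Gamma> r" "order_converges \<Gamma> r x 0"
  then have "((\<lambda>\<alpha>. f (x \<alpha>)) \<longlongrightarrow> 0) (net_filter \<Gamma> r)"
    by (rule order_continuous_dual_any_index[OF f])
  then show "((\<lambda>\<alpha>. - f (x \<alpha>)) \<longlongrightarrow> 0) (net_filter \<Gamma> r)"
    using tendsto_minus by fastforce
qed

lemma bounded_linear_in_order_continuous_dual:
  fixes f :: "'a::banach_lattice \<Rightarrow> real"
  assumes oc: "order_continuous_norm TYPE('a)" and f: "bounded_linear f"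
  shows "f \<in> order_continuous_dual"
  unfolding order_continuous_dual_def
proof (safe)
  show "linear f" using f by (rule bounded_linear.linear)
  fix \<Gamma> :: "'a set" and r and x :: "'a \<Rightarrow> 'a"
  assume dir: "directed_on \<Gamma> r" and "order_converges \<Gamma> r x 0"
  then obtain \<Lambda> :: "'a set" and s a where L: "directed_on \<Lambda> s" "decreases_to_0 \<Lambda> s a"
    and dom: "\<forall>\<gamma>\<in>\<Lambda>. \<exists>\<alpha>\<^sub>0\<in>\<Gamma>. \<forall>\<alpha>\<in>\<Gamma>. (\<alpha>\<^sub>0, \<alpha>) \<in> r \<longrightarrow> \<bar>x \<alpha> - 0\<bar> \<le> a \<gamma>"
    unfolding order_converges_def by blast
  have "(x \<longlongrightarrow> 0) (net_filter \<Gamma> r)"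
  proof (rule tendstoI)
    fix e :: real assume "e > 0"
    then have "\<forall>\<^sub>F \<gamma> in net_filter \<Lambda> s. norm (a \<gamma>) < e"
      using order_continuous_norm_any_index[OF oc L] by (auto simp: tendsto_iff dist_real_def)
    then obtain \<gamma> where \<gamma>: "\<gamma> \<in> \<Lambda>" "norm (a \<gamma>) < e"
      using L(1) unfolding eventually_net_filter[OF L(1)]
      by (auto simp: directed_on_def preorder_on_def refl_on_def)
    obtain \<alpha>\<^sub>0 where "\<alpha>\<^sub>0 \<in> \<Gamma>" "\<forall>\<alpha>\<in>\<Gamma>. (\<alpha>\<^sub>0, \<alpha>) \<in> r \<longrightarrow> \<bar>x \<alpha>\<bar> \<le> a \<gamma>"
      using dom \<gamma>(1) by auto
    then show "\<forall>\<^sub>F \<alpha> in net_filter \<Gamma> r. dist (x \<alpha>) 0 < e"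
      unfolding eventually_net_filter[OF dir] using \<gamma>(2) norm_mono_abs_le by fastforce
  qed
  then show "((\<lambda>\<alpha>. f (x \<alpha>)) \<longlongrightarrow> 0) (net_filter \<Gamma> r)"
    using bounded_linear.tendsto_zero[OF f] by blast
qed

lemma order_converges_if_decreases_to_0:
  fixes a :: "'i \<Rightarrow> 'a::vector_lattice"
  assumes dir: "directed_on \<Gamma> r" and dec: "decreases_to_0 \<Gamma> r a"
  shows "order_converges \<Gamma> r a 0"
proof (rule order_converges_any_index[OF dir dec], intro ballI)
  fix \<gamma> assume \<gamma>: "\<gamma> \<in> \<Gamma>"
  have "0 \<le> a \<alpha>" if "\<alpha> \<in> \<Gamma>" for \<alpha>
    using dec that by (auto simp: decreases_to_0_def isGlb_iff)
  then show "\<exists>\<alpha>\<^sub>0\<in>\<Gamma>. \<forall>\<alpha>\<in>\<Gamma>. (\<alpha>\<^sub>0, \<alpha>) \<in> r \<longrightarrow> \<bar>a \<alpha> - 0\<bar> \<le> a \<gamma>"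
    using dec \<gamma> by (auto simp: decreases_to_0_def intro!: bexI[of _ \<gamma>])
qed

section \<open>Order continuous functionals along increasing nets\<close>

text \<open>
  If \<open>p \<ge> 0\<close> lies below all \<open>z - inf (d \<gamma>) z\<close>, then subtracting \<open>p\<close> turns any upper bound \<open>u\<close> of
  \<open>d\<close> into another one: since \<open>z \<le> u\<close>,
  \<open>d \<gamma> = sup (d \<gamma>) z + inf (d \<gamma>) z - z \<le> u + (z - p) - z\<close>.
  Starting from \<open>y\<close>, all \<open>y - n *\<^sub>R p\<close> are upper bounds of \<open>d\<close>, hence above \<open>z \<ge> 0\<close>, and the
  Archimedean property gives \<open>p = 0\<close>.
\<close>

lemma decreases_to_0_meet_increasing_net:
  fixes d :: "'i \<Rightarrow> 'a::banach_lattice"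
  assumes inc: "increasing_net \<Gamma> r d"
    and y: "\<And>\<gamma>. \<gamma> \<in> \<Gamma> \<Longrightarrow> d \<gamma> \<le> y" and z: "0 \<le> z"
    and z_le: "\<And>u. (\<And>\<gamma>. \<gamma> \<in> \<Gamma> \<Longrightarrow> d \<gamma> \<le> u) \<Longrightarrow> z \<le> u"
  shows "decreases_to_0 \<Gamma> r (\<lambda>\<gamma>. z - inf (d \<gamma>) z)"
  unfolding decreases_to_0_def isGlb_iff
proof (intro conjI ballI impI allI)
  fix \<alpha> \<beta> assume "\<alpha> \<in> \<Gamma>" "\<beta> \<in> \<Gamma>" "(\<alpha>, \<beta>) \<in> r"
  then have "d \<alpha> \<le> d \<beta>" using inc by (auto simp: increasing_net_def)
  then show "z - inf (d \<beta>) z \<le> z - inf (d \<alpha>) z"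
    by (intro diff_left_mono) (auto intro: le_infI1)
next
  fix s assume "s \<in> (\<lambda>\<gamma>. z - inf (d \<gamma>) z) ` \<Gamma>"
  then obtain \<gamma> where s: "s = z - inf (d \<gamma>) z" by blast
  show "0 \<le> s" unfolding s by (simp only: diff_ge_0_iff_ge inf_le2)
next
  fix t assume t: "\<forall>s\<in>(\<lambda>\<gamma>. z - inf (d \<gamma>) z) ` \<Gamma>. t \<le> s"
  define p where "p = sup t 0"
  have step: "d \<gamma> \<le> u - p" if ub: "\<And>\<gamma>. \<gamma> \<in> \<Gamma> \<Longrightarrow> d \<gamma> \<le> u" and \<gamma>: "\<gamma> \<in> \<Gamma>" for u \<gamma>
  proof -
    have "0 \<le> z - inf (d \<gamma>) z" by (simp only: diff_ge_0_iff_ge inf_le2)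
    then have "p \<le> z - inf (d \<gamma>) z" unfolding p_def using t \<gamma> by (intro sup_least) blast+
    then have 1: "inf (d \<gamma>) z \<le> z - p" by (metis add.commute le_diff_eq)
    have 2: "sup (d \<gamma>) z \<le> u" using ub[OF \<gamma>] z_le[of u] ub by simp
    have "d \<gamma> = sup (d \<gamma>) z + inf (d \<gamma>) z - z"
      using add_eq_inf_sup[of "d \<gamma>" z] by (simp add: algebra_simps)
    also have "\<dots> \<le> u + (z - p) - z"
      by (intro diff_right_mono add_mono 1 2)
    finally show ?thesis by simp
  qed
  have ub: "d \<gamma> \<le> y - real n *\<^sub>R p" if "\<gamma> \<in> \<Gamma>" for n \<gamma>
    using that
  proof (induction n arbitrary: \<gamma>)
    case (Suc n)
    have "d \<gamma> \<le> (y - real n *\<^sub>R p) - p" by (rule step) (use Suc in auto)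
    then show ?case by (simp add: algebra_simps)
  qed (use y in auto)
  have "real n *\<^sub>R p \<le> y" for n
  proof -
    have "z \<le> y - real n *\<^sub>R p" by (rule z_le) (rule ub)
    then have "0 \<le> y - real n *\<^sub>R p" using z by (rule order_trans[rotated])
    then show ?thesis by simp
  qed
  then have "p = 0" by (intro archimedean_banach_lattice) (auto simp: p_def)
  then show "t \<le> 0" by (metis p_def sup.cobounded1)
qed

text \<open>
  The supremum of \<open>f\<close> over the union of the intervals \<open>{0..x \<gamma>}\<close> is finite, and \<open>\<alpha>\<^sub>0\<close> is chosen
  such that \<open>f\<close> nearly attains it on \<open>{0..x \<alpha>\<^sub>0}\<close>. For positive \<open>f\<close> and increasing \<open>x\<close> this is the
  Cauchy property of the bounded increasing net of the \<open>f (x \<gamma>)\<close>.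
\<close>

lemma functional_small_on_increments:
  fixes f :: "'a::banach_lattice \<Rightarrow> real"
  assumes f: "bounded_linear f" and ne: "\<Gamma> \<noteq> {}" and bdd: "bounded (x ` \<Gamma>)"
    and pos: "\<forall>\<alpha>\<in>\<Gamma>. 0 \<le> x \<alpha>" and e: "e > 0"
  obtains \<alpha>\<^sub>0 where "\<alpha>\<^sub>0 \<in> \<Gamma>"
    "\<And>\<gamma> v. \<gamma> \<in> \<Gamma> \<Longrightarrow> 0 \<le> v \<Longrightarrow> v \<le> x \<gamma> - x \<alpha>\<^sub>0 \<Longrightarrow> f v \<le> e"
proof -
  obtain K where K: "K > 0" "\<And>v. norm (f v) \<le> norm v * K"
    using bounded_linear.pos_bounded[OF f] by blast
  obtain M where M: "\<And>\<gamma>. \<gamma> \<in> \<Gamma> \<Longrightarrow> norm (x \<gamma>) \<le> M"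
    using bdd by (auto simp: bounded_iff)
  define S where "S = {f v |v \<gamma>. \<gamma> \<in> \<Gamma> \<and> 0 \<le> v \<and> v \<le> x \<gamma>}"
  have bS: "bdd_above S"
  proof (rule bdd_aboveI)
    fix s assume "s \<in> S"
    then obtain v \<gamma> where v: "s = f v" "\<gamma> \<in> \<Gamma>" "0 \<le> v" "v \<le> x \<gamma>" by (auto simp: S_def)
    have "norm v \<le> norm (x \<gamma>)" using v by (intro norm_mono_abs_le) simp
    then have "norm v * K \<le> M * K"
      using M[OF v(2)] K(1) by (intro mult_right_mono) auto
    then show "s \<le> M * K" using K(2)[of v] v(1) by simp
  qed
  have "S \<noteq> {}" using ne pos by (fastforce simp: S_def)
  then obtain s where "s \<in> S" "s > Sup S - e"
    using less_cSupD[of S "Sup S - e"] e by auto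
  then obtain w \<alpha>\<^sub>0 where w: "f w > Sup S - e" "\<alpha>\<^sub>0 \<in> \<Gamma>" "0 \<le> w" "w \<le> x \<alpha>\<^sub>0"
    by (auto simp: S_def)
  show ?thesis
  proof (rule that[OF w(2)])
    fix \<gamma> v assume v: "\<gamma> \<in> \<Gamma>" "0 \<le> v" "v \<le> x \<gamma> - x \<alpha>\<^sub>0"
    \<comment> \<open>The interval \<open>{0..x \<gamma>}\<close> contains \<open>{0..x \<gamma> - x \<alpha>\<^sub>0} + {0..x \<alpha>\<^sub>0}\<close>, and on the second
      summand \<open>f\<close> already comes within \<open>e\<close> of the supremum.\<close>
    have "v + w \<le> x \<gamma>" using add_mono[OF v(3) w(4)] by simp
    then have "f (v + w) \<in> S" unfolding S_def using v(1,2) w(3) add_nonneg_nonneg by blast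
    then have "f v + f w \<le> Sup S"
      using cSup_upper[OF _ bS] linear_add[OF bounded_linear.linear[OF f], of v w] by simp
    then show "f v \<le> e" using w(1) by simp
  qed
qed

text \<open>
  The hypothesis on \<open>z\<close> says that, in the Dedekind completion, \<open>z\<close> lies below the supremum over
  \<open>\<gamma>\<close> of \<open>inf (sup (x \<gamma> - x \<alpha>) 0) y\<close> for every \<open>\<alpha>\<close>. The positive part \<open>sup (x \<gamma> - x \<alpha>) 0\<close> makes
  these elements positive and increasing in \<open>\<gamma>\<close> on the whole index set, not only beyond \<open>\<alpha>\<close>. For
  \<open>e > 0\<close> and suitable \<open>\<alpha>\<close> and \<open>\<gamma>\<close>, \<open>f z\<close> is within \<open>e / 2\<close> of the value of \<open>f\<close> at their meet
  with \<open>z\<close>, and this value is at most \<open>e / 2\<close>.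
\<close>

lemma order_continuous_functional_nonpos:
  fixes x :: "'i \<Rightarrow> 'a::banach_lattice"
  assumes f: "f \<in> order_continuous_dual" and dir: "directed_on \<Gamma> r" and bdd: "bounded (x ` \<Gamma>)"
    and pos: "\<forall>\<alpha>\<in>\<Gamma>. 0 \<le> x \<alpha>" and inc: "increasing_net \<Gamma> r x"
    and y: "0 \<le> y" and z: "0 \<le> z"
    and z_le: "\<And>\<alpha> u. \<alpha> \<in> \<Gamma> \<Longrightarrow> (\<And>\<gamma>. \<gamma> \<in> \<Gamma> \<Longrightarrow> inf (sup (x \<gamma> - x \<alpha>) 0) y \<le> u) \<Longrightarrow> z \<le> u"
  shows "f z \<le> 0"
proof (rule field_le_epsilon)
  fix e :: real assume "e > 0"
  then have e2: "e / 2 > 0" by simp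
  note bl = order_continuous_dual_bounded_linear[OF f]
  have ne: "\<Gamma> \<noteq> {}" using dir by (simp add: directed_on_def)
  obtain \<alpha>\<^sub>0 where \<alpha>\<^sub>0: "\<alpha>\<^sub>0 \<in> \<Gamma>"
    "\<And>\<gamma> v. \<gamma> \<in> \<Gamma> \<Longrightarrow> 0 \<le> v \<Longrightarrow> v \<le> x \<gamma> - x \<alpha>\<^sub>0 \<Longrightarrow> f v \<le> e / 2"
    using functional_small_on_increments[OF bl ne bdd pos e2] by blast
  define d where "d \<gamma> = inf (sup (x \<gamma> - x \<alpha>\<^sub>0) 0) y" for \<gamma>
  have dinc: "increasing_net \<Gamma> r d"
    unfolding increasing_net_def d_def
  proof (intro ballI impI)
    fix \<alpha> \<beta> assume "\<alpha> \<in> \<Gamma>" "\<beta> \<in> \<Gamma>" "(\<alpha>, \<beta>) \<in> r"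
    then have "x \<alpha> \<le> x \<beta>" using inc by (auto simp: increasing_net_def)
    then show "inf (sup (x \<alpha> - x \<alpha>\<^sub>0) 0) y \<le> inf (sup (x \<beta> - x \<alpha>\<^sub>0) 0) y"
      by (intro inf_mono sup_mono diff_right_mono order_refl)
  qed
  have dec: "decreases_to_0 \<Gamma> r (\<lambda>\<gamma>. z - inf (d \<gamma>) z)"
  proof (rule decreases_to_0_meet_increasing_net[OF dinc _ z])
    show "d \<gamma> \<le> y" for \<gamma> by (simp add: d_def)
    show "z \<le> u" if "\<And>\<gamma>. \<gamma> \<in> \<Gamma> \<Longrightarrow> d \<gamma> \<le> u" for u
      using z_le[OF \<alpha>\<^sub>0(1)] that by (simp add: d_def)
  qed
  have "order_converges \<Gamma> r (\<lambda>\<gamma>. z - inf (d \<gamma>) z) 0"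
    by (rule order_converges_if_decreases_to_0[OF dir dec])
  from tendstoD[OF order_continuous_dual_any_index[OF f dir this] e2]
  have "\<forall>\<^sub>F \<gamma> in net_filter \<Gamma> r. \<bar>f (z - inf (d \<gamma>) z)\<bar> < e / 2"
    by (simp only: dist_real_def diff_zero)
  then obtain \<beta> where \<beta>: "\<beta> \<in> \<Gamma>" "\<And>\<gamma>. \<gamma> \<in> \<Gamma> \<Longrightarrow> (\<beta>, \<gamma>) \<in> r \<Longrightarrow> \<bar>f (z - inf (d \<gamma>) z)\<bar> < e / 2"
    unfolding eventually_net_filter[OF dir] by blast
  obtain \<gamma> where \<gamma>: "\<gamma> \<in> \<Gamma>" "(\<alpha>\<^sub>0, \<gamma>) \<in> r" "(\<beta>, \<gamma>) \<in> r"
    using dir \<alpha>\<^sub>0(1) \<beta>(1) unfolding directed_on_def by blast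
  have "0 \<le> x \<gamma> - x \<alpha>\<^sub>0"
    using inc \<alpha>\<^sub>0(1) \<gamma> by (auto simp: increasing_net_def)
  then have "inf (d \<gamma>) z \<le> x \<gamma> - x \<alpha>\<^sub>0"
    by (auto simp: d_def sup_absorb1 intro: le_infI1)
  moreover have "0 \<le> inf (d \<gamma>) z" using y z by (simp add: d_def)
  ultimately have "f (inf (d \<gamma>) z) \<le> e / 2" using \<alpha>\<^sub>0(2) \<gamma> by blast
  moreover have "f (z - inf (d \<gamma>) z) = f z - f (inf (d \<gamma>) z)"
    by (rule linear_diff[OF bounded_linear.linear[OF bl]])
  ultimately show "f z \<le> 0 + e" using \<beta>(2)[OF \<gamma>(1,3)] by linarith
qed

section \<open>Unbounded order Cauchy nets\<close>

text \<open>
  The eventual upper bounds of \<open>\<bar>x \<alpha> - l\<bar>\<close> are closed under \<open>inf\<close> since the index set is directed.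
  Hence, ordered downwards and indexed by themselves, they form the dominating net.
\<close>

lemma order_converges_if_isGlb_eventual_bounds:
  fixes x :: "'i \<Rightarrow> 'a::vector_lattice" and l :: 'a
  assumes dir: "directed_on \<Gamma> r"
  defines "A \<equiv> {u. \<exists>\<alpha>\<^sub>0\<in>\<Gamma>. \<forall>\<alpha>\<in>\<Gamma>. (\<alpha>\<^sub>0, \<alpha>) \<in> r \<longrightarrow> \<bar>x \<alpha> - l\<bar> \<le> u}"
  assumes ne: "A \<noteq> {}" and glb: "isGlb UNIV A 0"
  shows "order_converges \<Gamma> r x l"
proof (rule order_converges_any_index[where a = "\<lambda>u. u"])
  let ?s = "{(u, v). u \<in> A \<and> v \<in> A \<and> v \<le> u}"
  have inf_A: "inf u v \<in> A" if uv: "u \<in> A" "v \<in> A" for u v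
  proof -
    obtain \<alpha> \<beta> where ab: "\<alpha> \<in> \<Gamma>" "\<forall>\<gamma>\<in>\<Gamma>. (\<alpha>, \<gamma>) \<in> r \<longrightarrow> \<bar>x \<gamma> - l\<bar> \<le> u"
        "\<beta> \<in> \<Gamma>" "\<forall>\<gamma>\<in>\<Gamma>. (\<beta>, \<gamma>) \<in> r \<longrightarrow> \<bar>x \<gamma> - l\<bar> \<le> v"
      using uv by (auto simp: A_def)
    then obtain \<delta> where \<delta>: "\<delta> \<in> \<Gamma>" "(\<alpha>, \<delta>) \<in> r" "(\<beta>, \<delta>) \<in> r"
      using dir unfolding directed_on_def by blast
    have "trans r" using dir by (simp add: directed_on_def preorder_on_def)
    then have "\<forall>\<gamma>\<in>\<Gamma>. (\<delta>, \<gamma>) \<in> r \<longrightarrow> \<bar>x \<gamma> - l\<bar> \<le> inf u v"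
      using ab \<delta> by (meson le_infI transD)
    then show ?thesis using \<delta>(1) by (auto simp: A_def)
  qed
  show "directed_on A ?s"
    unfolding directed_on_def
  proof (intro conjI ballI)
    show "preorder_on A ?s"
      unfolding preorder_on_def by (auto simp: refl_on_def trans_def)
    fix u v assume "u \<in> A" "v \<in> A"
    then show "\<exists>w\<in>A. (u, w) \<in> ?s \<and> (v, w) \<in> ?s"
      using inf_A by (intro bexI[of _ "inf u v"]) auto
  qed (rule ne)
  show "decreases_to_0 A ?s (\<lambda>u. u)"
    using glb by (auto simp: decreases_to_0_def)
  show "\<forall>u\<in>A. \<exists>\<alpha>\<^sub>0\<in>\<Gamma>. \<forall>\<alpha>\<in>\<Gamma>. (\<alpha>\<^sub>0, \<alpha>) \<in> r \<longrightarrow> \<bar>x \<alpha> - l\<bar> \<le> u"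
    by (auto simp: A_def)
qed

lemma directed_on_coordinatewise:
  assumes "directed_on \<Gamma> r"
  shows "directed_on (\<Gamma> \<times> \<Gamma>) (coordinatewise r)"
  unfolding directed_on_def
proof (intro conjI ballI)
  show "\<Gamma> \<times> \<Gamma> \<noteq> {}" using assms by (auto simp: directed_on_def)
  show "preorder_on (\<Gamma> \<times> \<Gamma>) (coordinatewise r)"
    using assms unfolding directed_on_def preorder_on_def coordinatewise_def
    by (auto simp: refl_on_def intro!: transI dest: transD)
  fix p q assume "p \<in> \<Gamma> \<times> \<Gamma>" "q \<in> \<Gamma> \<times> \<Gamma>"
  then obtain a b a' b' where pq: "p = (a, b)" "q = (a', b')" "a \<in> \<Gamma>" "b \<in> \<Gamma>" "a' \<in> \<Gamma>" "b' \<in> \<Gamma>"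
    by auto
  obtain c c' where "c \<in> \<Gamma>" "(a, c) \<in> r" "(a', c) \<in> r" "c' \<in> \<Gamma>" "(b, c') \<in> r" "(b', c') \<in> r"
    using assms pq unfolding directed_on_def by metis
  then show "\<exists>s\<in>\<Gamma> \<times> \<Gamma>. (p, s) \<in> coordinatewise r \<and> (q, s) \<in> coordinatewise r"
    by (auto simp: pq coordinatewise_def intro!: bexI[of _ "(c, c')"])
qed

lemma abs_diff_le_increasing_net:
  fixes x :: "'i \<Rightarrow> 'a::vector_lattice"
  assumes inc: "increasing_net \<Gamma> r x"
    and mem: "\<alpha>\<^sub>0 \<in> \<Gamma>" "\<alpha> \<in> \<Gamma>" "\<beta> \<in> \<Gamma>" "\<gamma> \<in> \<Gamma>"
    and rel: "(\<alpha>\<^sub>0, \<alpha>) \<in> r" "(\<alpha>\<^sub>0, \<beta>) \<in> r" "(\<alpha>, \<gamma>) \<in> r" "(\<beta>, \<gamma>) \<in> r"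
  shows "\<bar>x \<alpha> - x \<beta>\<bar> \<le> x \<gamma> - x \<alpha>\<^sub>0"
proof (rule abs_leI)
  have le: "x \<alpha>\<^sub>0 \<le> x \<alpha>" "x \<alpha>\<^sub>0 \<le> x \<beta>" "x \<alpha> \<le> x \<gamma>" "x \<beta> \<le> x \<gamma>"
    using inc mem rel by (auto simp: increasing_net_def)
  show "x \<alpha> - x \<beta> \<le> x \<gamma> - x \<alpha>\<^sub>0" by (rule diff_mono) (use le in auto)
  have "x \<beta> - x \<alpha> \<le> x \<gamma> - x \<alpha>\<^sub>0" by (rule diff_mono) (use le in auto)
  then show "- (x \<alpha> - x \<beta>) \<le> x \<gamma> - x \<alpha>\<^sub>0" by simp
qed

lemma uo_Cauchy_increasing_net:
  fixes x :: "'i \<Rightarrow> 'a::banach_lattice"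
  assumes sep: "separates_points (order_continuous_dual :: ('a \<Rightarrow> real) set)"
    and dir: "directed_on \<Gamma> r" and bdd: "bounded (x ` \<Gamma>)"
    and pos: "\<forall>\<alpha>\<in>\<Gamma>. 0 \<le> x \<alpha>" and inc: "increasing_net \<Gamma> r x"
  shows "uo_Cauchy \<Gamma> r x"
  unfolding uo_Cauchy_def uo_converges_def
proof (intro allI impI)
  fix y :: 'a assume y: "0 \<le> y"
  let ?x = "\<lambda>p. inf \<bar>(case p of (\<alpha>, \<alpha>') \<Rightarrow> x \<alpha> - x \<alpha>') - 0\<bar> y"
  let ?\<Gamma> = "\<Gamma> \<times> \<Gamma>" and ?r = "coordinatewise r"
  define A where "A = {u. \<exists>p\<in>?\<Gamma>. \<forall>q\<in>?\<Gamma>. (p, q) \<in> ?r \<longrightarrow> \<bar>?x q - 0\<bar> \<le> u}"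
  have x_pos: "\<bar>?x q - 0\<bar> = ?x q" for q
    using y by simp
  have in_A: "u \<in> A" if \<alpha>: "\<alpha> \<in> \<Gamma>" and u: "\<And>\<gamma>. \<gamma> \<in> \<Gamma> \<Longrightarrow> inf (sup (x \<gamma> - x \<alpha>) 0) y \<le> u" for \<alpha> u
  proof -
    have "\<bar>?x q - 0\<bar> \<le> u" if q: "q \<in> ?\<Gamma>" "((\<alpha>, \<alpha>), q) \<in> ?r" for q
    proof -
      obtain a b where ab: "q = (a, b)" "a \<in> \<Gamma>" "b \<in> \<Gamma>" "(\<alpha>, a) \<in> r" "(\<alpha>, b) \<in> r"
        using q by (auto simp: coordinatewise_def)
      obtain \<gamma> where \<gamma>: "\<gamma> \<in> \<Gamma>" "(a, \<gamma>) \<in> r" "(b, \<gamma>) \<in> r"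
        using dir ab unfolding directed_on_def by blast
      have "\<bar>x a - x b\<bar> \<le> x \<gamma> - x \<alpha>"
        using abs_diff_le_increasing_net[OF inc \<alpha> ab(2,3) \<gamma>(1) ab(4,5) \<gamma>(2,3)] .
      then have "inf \<bar>x a - x b\<bar> y \<le> inf (sup (x \<gamma> - x \<alpha>) 0) y"
        by (intro inf_mono) (auto intro: le_supI1)
      also have "\<dots> \<le> u" by (rule u[OF \<gamma>(1)])
      finally show ?thesis unfolding x_pos by (simp add: ab(1))
    qed
    then show ?thesis unfolding A_def using \<alpha> by blast
  qed
  show "order_converges ?\<Gamma> ?r ?x 0"
  proof (rule order_converges_if_isGlb_eventual_bounds[OF directed_on_coordinatewise[OF dir]],
      unfold A_def[symmetric])
    obtain \<alpha> where "\<alpha> \<in> \<Gamma>" using dir by (auto simp: directed_on_def)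
    then have "y \<in> A" by (rule in_A) simp
    then show "A \<noteq> {}" by blast
    have lower: "0 \<le> u" if u: "u \<in> A" for u
    proof -
      obtain p where p: "p \<in> ?\<Gamma>" "\<forall>q\<in>?\<Gamma>. (p, q) \<in> ?r \<longrightarrow> \<bar>?x q - 0\<bar> \<le> u"
        using u unfolding A_def by blast
      have "(p, p) \<in> ?r"
        using directed_on_coordinatewise[OF dir] p(1)
        unfolding directed_on_def preorder_on_def refl_on_def by blast
      with p have "\<bar>?x p - 0\<bar> \<le> u" by blast
      then show ?thesis by (rule order_trans[OF abs_ge_zero])
    qed
    have "t \<le> 0" if t: "\<forall>u\<in>A. t \<le> u" for t
    proof -
      define z where "z = sup t 0"
      have z: "0 \<le> z" by (simp add: z_def)
      \<comment> \<open>Passing from the lower bound \<open>t\<close> to its positive part loses nothing, because all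
        eventual upper bounds are positive.\<close>
      have z_le: "z \<le> u" if "\<alpha> \<in> \<Gamma>" "\<And>\<gamma>. \<gamma> \<in> \<Gamma> \<Longrightarrow> inf (sup (x \<gamma> - x \<alpha>) 0) y \<le> u" for \<alpha> u
        using in_A[OF that] t lower[of u] unfolding z_def by (intro sup_least) blast+
      have "f z = 0" if f: "f \<in> order_continuous_dual" for f
      proof -
        note nonpos = order_continuous_functional_nonpos[OF _ dir bdd pos inc y z z_le]
        have "f z \<le> 0" by (rule nonpos[OF f])
        moreover have "- f z \<le> 0" by (rule nonpos[OF uminus_in_order_continuous_dual[OF f]])
        ultimately show ?thesis by simp
      qed
      then have "z = 0" using sep by (auto simp: separates_points_def)
      then show ?thesis by (metis z_def sup.cobounded1)
    qed
    then show "isGlb UNIV A 0" unfolding isGlb_iff using lower by blast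
  qed
qed

theorem theorem2p3:
  fixes \<Gamma> :: "'i set" and r :: "'i rel" and x :: "'i \<Rightarrow> 'a::banach_lattice"
  shows "(order_continuous_norm TYPE('a) \<longrightarrow>
            separates_points (order_continuous_dual :: ('a \<Rightarrow> real) set)) \<and>
         (separates_points (order_continuous_dual :: ('a \<Rightarrow> real) set) \<longrightarrow>
            directed_on \<Gamma> r \<longrightarrow> bounded (x ` \<Gamma>) \<longrightarrow>
            (\<forall>\<alpha>\<in>\<Gamma>. 0 \<le> x \<alpha>) \<longrightarrow> increasing_net \<Gamma> r x \<longrightarrow>
            uo_Cauchy \<Gamma> r x)"
proof (intro conjI impI)
  assume oc: "order_continuous_norm TYPE('a)"
  show "separates_points (order_continuous_dual :: ('a \<Rightarrow> real) set)"
    unfolding separates_points_def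
    using bounded_functional_nonzero_at bounded_linear_in_order_continuous_dual[OF oc] by metis
qed (rule uo_Cauchy_increasing_net)

end
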